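(* Let $M, N, L$ be positive integers with $M < N$, let $\boldsymbol{a} : [0,2\pi)\times(0,\pi) \to \mathbb{C}^N$ be an array manifold (an arbitrary function), and let $\boldsymbol{\Theta} = \big((\Theta_{1,1},\Theta_{1,2}),\dots,(\Theta_{L,1},\Theta_{L,2})\big) \in ([0,2\pi)\times(0,\pi))^L$ be given. Set $$\boldsymbol{A} = [\boldsymbol{a}(\Theta_{1,1},\Theta_{1,2}),\dots,\boldsymbol{a}(\Theta_{L,1},\Theta_{L,2})] \in \mathbb{C}^{N\times L},$$ and for $\boldsymbol{\Phi}\in\mathbb{C}^{M\times N}$ set $\boldsymbol{G}_{\boldsymbol{\Phi}} = \boldsymbol{\Phi}^{\rm H}\boldsymbol{\Phi}$ and $$\boldsymbol{E}(\boldsymbol{\Phi}) = \boldsymbol{A}^{\rm H}\boldsymbol{G}_{\boldsymbol{\Phi}}\boldsymbol{A} - \boldsymbol{A}^{\rm H}\boldsymbol{A} \in \mathbb{C}^{L\times L}.$$ Then for every $\boldsymbol{\Phi}\in\mathbb{C}^{M\times N}$, $$\nabla_{\boldsymbol{\Phi}} \Vert \boldsymbol{E}(\boldsymbol{\Phi})\Vert_F^2 = 4\,\boldsymbol{\Phi}\boldsymbol{A}\boldsymbol{A}^{\rm H}\boldsymbol{G}_{\boldsymbol{\Phi}}\boldsymbol{A}\boldsymbol{A}^{\rm H} - 4\,\boldsymbol{\Phi}\boldsymbol{A}\boldsymbol{A}^{\rm H}\boldsymbol{A}\boldsymbol{A}^{\rm H}.$$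
   Context: $(\cdot)^{\rm H}$ denotes the conjugate transpose and $\Vert\cdot\Vert_F$ the Frobenius norm. For a real-valued function $f:\mathbb{C}^{M\times N}\to\mathbb{R}$ that is differentiable in the real sense, $\nabla_{\boldsymbol{\Phi}} f(\boldsymbol{\Phi}) \in \mathbb{C}^{M\times N}$ is the gradient with respect to the real inner product $\langle \boldsymbol{X},\boldsymbol{Y}\rangle = \Re\,\mathrm{tr}(\boldsymbol{X}^{\rm H}\boldsymbol{Y})$, i.e. the unique matrix for which the real derivative of $f$ at $\boldsymbol{\Phi}$ in any direction $\boldsymbol{H}\in\mathbb{C}^{M\times N}$ equals $\Re\,\mathrm{tr}\big((\nabla_{\boldsymbol{\Phi}} f(\boldsymbol{\Phi}))^{\rm H}\boldsymbol{H}\big)$. Equivalently, its entries are $\partial f/\partial \Re\Phi_{m,n} + \jmath\,\partial f/\partial \Im\Phi_{m,n}$, where $\jmath$ is the imaginary unit. With this convention, for example, $\nabla_{\boldsymbol{X}}\mathrm{tr}(\boldsymbol{X}\boldsymbol{M}\boldsymbol{X}^{\rm H}) = 2\boldsymbol{X}\boldsymbol{M}$ for Hermitian $\boldsymbol{M}$. *)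

theory Defs
  imports "HOL-Analysis.Analysis"
begin

text \<open>
  \<^typ>\<open>complex^'n^'m\<close> is the space of matrices with rows indexed by \<^typ>\<open>'m\<close> and columns by
  \<^typ>\<open>'n\<close>, so \<open>A $ i $ j\<close> is the entry in row \<open>i\<close> and column \<open>j\<close>.
\<close>

definition hermitian_transpose :: "complex^'n^'m \<Rightarrow> complex^'m^'n"  (\<open>_\<^sup>H\<close> [1000] 999)
  where "A\<^sup>H = (\<chi> i j. cnj (A $ j $ i))"

text \<open>
  The library norm on \<^typ>\<open>complex^'n^'m\<close> is the Frobenius norm, and the library inner product
  is the real part of \<open>trace (X\<^sup>H ** Y)\<close>. Hence \<^const>\<open>gderiv\<close>, which is Frechet
  differentiability together with the representation of the derivative by the inner product, is
  the gradient relation for that real inner product.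
\<close>

lemma norm_matrix_eq_Frobenius:
  fixes A :: "complex^'n^'m"
  shows "norm A = sqrt (\<Sum>i\<in>UNIV. \<Sum>j\<in>UNIV. (cmod (A $ i $ j))\<^sup>2)"
  by (simp add: norm_vec_def L2_set_def sum_nonneg)

lemma inner_matrix_eq_Re_trace:
  fixes X Y :: "complex^'n^'m"
  shows "X \<bullet> Y = Re (trace (X\<^sup>H ** Y))"
proof -
  have "X \<bullet> Y = (\<Sum>i\<in>UNIV. \<Sum>j\<in>UNIV. Re (cnj (X $ i $ j) * Y $ i $ j))"
    by (simp add: inner_vec_def inner_complex_def)
  also have "\<dots> = (\<Sum>j\<in>UNIV. \<Sum>i\<in>UNIV. Re (cnj (X $ i $ j) * Y $ i $ j))"
    by (rule sum.swap)
  also have "\<dots> = Re (trace (X\<^sup>H ** Y))"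
    by (simp add: trace_def matrix_matrix_mult_def hermitian_transpose_def)
  finally show ?thesis .
qed

lemma gderiv_matrix_iff:
  fixes f :: "complex^'n^'m \<Rightarrow> real"
  shows "GDERIV f \<Phi> :> D \<longleftrightarrow>
    (f has_derivative (\<lambda>H. Re (trace (D\<^sup>H ** H)))) (at \<Phi>)"
  by (simp only: gderiv_def inner_commute[of _ D] inner_matrix_eq_Re_trace[of D])

lemma gderiv_unique:
  assumes "GDERIV f x :> D" and "GDERIV f x :> D'"
  shows "D = D'"
proof -
  have "(\<lambda>h. h \<bullet> D) = (\<lambda>h. h \<bullet> D')"
    using assms unfolding gderiv_def by (rule has_derivative_unique)
  then have "\<forall>h. h \<bullet> D = h \<bullet> D'"
    by (simp add: fun_eq_iff)
  then show ?thesis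
    by (simp add: vector_eq_ldot)
qed

definition manifold_matrix ::
    "(real \<times> real \<Rightarrow> complex^'n) \<Rightarrow> (real \<times> real)^'l \<Rightarrow> complex^'l^'n"
  where "manifold_matrix a \<Theta> = (\<chi> i l. a (\<Theta> $ l) $ i)"

definition gram :: "complex^'n^'m \<Rightarrow> complex^'n^'n"
  where "gram \<Phi> = \<Phi>\<^sup>H ** \<Phi>"

definition gram_error :: "complex^'l^'n \<Rightarrow> complex^'n^'m \<Rightarrow> complex^'l^'l"
  where "gram_error A \<Phi> = A\<^sup>H ** gram \<Phi> ** A - A\<^sup>H ** A"

end

theory Submission
  imports Defs
begin

text \<open>
  Put \<open>D H = A\<^sup>H ** \<Phi>\<^sup>H ** H ** A\<close>. The derivative of \<open>\<parallel>E\<parallel>\<^sup>2\<close> in direction \<open>H\<close> is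
  \<open>2 (E \<bullet> (D H + (D H)\<^sup>H))\<close>, which is \<open>4 (E \<bullet> D H)\<close> because \<open>E\<close> is Hermitian. Left and right
  multiplication by a matrix are adjoint to multiplication by its conjugate transpose, so this
  is the inner product of \<open>H\<close> with \<open>4 \<Phi> ** A ** E ** A\<^sup>H\<close>.
\<close>

lemma hermitian_transpose_involution [simp]: "(X\<^sup>H)\<^sup>H = X"
  by (simp add: hermitian_transpose_def vec_eq_iff)

lemma hermitian_transpose_mult: "(X ** Y)\<^sup>H = Y\<^sup>H ** X\<^sup>H"
  by (simp add: hermitian_transpose_def vec_eq_iff matrix_matrix_mult_def mult.commute)

lemma hermitian_transpose_diff: "(X - Y)\<^sup>H = X\<^sup>H - Y\<^sup>H"
  by (simp add: hermitian_transpose_def vec_eq_iff)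

text \<open>Transposition only reorders the entries, and conjugation preserves the real inner
  product on the complex numbers.\<close>

lemma inner_hermitian_transpose:
  fixes X Y :: "complex^'n^'m"
  shows "X\<^sup>H \<bullet> Y\<^sup>H = X \<bullet> Y"
proof -
  have "X\<^sup>H \<bullet> Y\<^sup>H = (\<Sum>j\<in>UNIV. \<Sum>i\<in>UNIV. X $ i $ j \<bullet> Y $ i $ j)"
    by (simp add: inner_vec_def hermitian_transpose_def inner_complex_def)
  also have "\<dots> = (\<Sum>i\<in>UNIV. \<Sum>j\<in>UNIV. X $ i $ j \<bullet> Y $ i $ j)"
    by (rule sum.swap)
  finally show ?thesis
    by (simp add: inner_vec_def)
qed

text \<open>Both sides are the real part of the trace of \<open>Z\<^sup>H ** X ** Y\<close>.\<close>

lemma inner_matrix_mult_left: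
  fixes X :: "complex^'n^'m" and Y :: "complex^'k^'n"
  shows "Z \<bullet> (X ** Y) = (X\<^sup>H ** Z) \<bullet> Y"
  by (simp add: inner_matrix_eq_Re_trace hermitian_transpose_mult matrix_mul_assoc)

text \<open>Conjugate transposition of both arguments reverses the product, which reduces this to
  the adjoint of left multiplication.\<close>

lemma inner_matrix_mult_right:
  fixes X :: "complex^'n^'m" and Y :: "complex^'k^'n"
  shows "Z \<bullet> (X ** Y) = (Z ** Y\<^sup>H) \<bullet> X"
proof -
  have "Z \<bullet> (X ** Y) = Z\<^sup>H \<bullet> (Y\<^sup>H ** X\<^sup>H)"
    by (metis inner_hermitian_transpose hermitian_transpose_mult)
  also have "\<dots> = (Y ** Z\<^sup>H) \<bullet> X\<^sup>H"
    by (simp add: inner_matrix_mult_left)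
  also have "\<dots> = (Z ** Y\<^sup>H)\<^sup>H \<bullet> X\<^sup>H"
    by (simp add: hermitian_transpose_mult)
  also have "\<dots> = (Z ** Y\<^sup>H) \<bullet> X"
    by (rule inner_hermitian_transpose)
  finally show ?thesis .
qed

text \<open>The map is conjugate-linear over the complex numbers, but real linearity is enough for a
  real derivative; boundedness is automatic in finite dimension.\<close>

lemma bounded_linear_hermitian_transpose:
  "bounded_linear (hermitian_transpose :: complex^'n^'m \<Rightarrow> complex^'m^'n)"
  by (intro linear_conv_bounded_linear[THEN iffD1] linearI)
    (simp_all add: hermitian_transpose_def vec_eq_iff)

lemma bounded_bilinear_matrix_mult:
  "bounded_bilinear ((**) :: complex^'n^'m \<Rightarrow> complex^'k^'n \<Rightarrow> complex^'k^'m)"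
  by (intro bilinear_conv_bounded_bilinear[THEN iffD1])
    (auto simp: bilinear_def vec_eq_iff matrix_matrix_mult_def sum.distrib scaleR_sum_right
      distrib_left distrib_right intro!: linearI)

lemmas has_derivative_matrix_mult =
  bounded_bilinear.FDERIV[OF bounded_bilinear_matrix_mult]

lemmas has_derivative_hermitian_transpose =
  bounded_linear.has_derivative[OF bounded_linear_hermitian_transpose]

lemma hermitian_transpose_gram [simp]: "(gram \<Phi>)\<^sup>H = gram \<Phi>"
  by (simp add: gram_def hermitian_transpose_mult)

lemma hermitian_transpose_gram_error [simp]: "(gram_error A \<Phi>)\<^sup>H = gram_error A \<Phi>"
  by (simp add: gram_error_def hermitian_transpose_diff hermitian_transpose_mult matrix_mul_assoc)

lemma has_derivative_gram_error:
  fixes A :: "complex^'l^'n" and \<Phi> :: "complex^'n^'m"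
  shows "(gram_error A has_derivative
    (\<lambda>H. A\<^sup>H ** \<Phi>\<^sup>H ** H ** A + (A\<^sup>H ** \<Phi>\<^sup>H ** H ** A)\<^sup>H)) (at \<Phi>)"
proof -
  \<comment> \<open>In this form the variable enters only through the linear map
    \<open>\<Psi> ** A\<close>, so the product rule gives two terms that are conjugate transposes of
    each other.\<close>
  have "gram_error A = (\<lambda>\<Psi> :: complex^'n^'m. (\<Psi> ** A)\<^sup>H ** (\<Psi> ** A) - A\<^sup>H ** A)"
    by (simp add: fun_eq_iff gram_error_def gram_def hermitian_transpose_mult matrix_mul_assoc)
  moreover have "((\<lambda>\<Psi> :: complex^'n^'m. \<Psi> ** A) has_derivative (\<lambda>H. H ** A)) (at \<Phi>)"
    by (rule bounded_linear_imp_has_derivative)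
      (rule bounded_bilinear.bounded_linear_left[OF bounded_bilinear_matrix_mult])
  then have "((\<lambda>\<Psi>. (\<Psi> ** A)\<^sup>H ** (\<Psi> ** A) - A\<^sup>H ** A) has_derivative
      (\<lambda>H. (\<Phi> ** A)\<^sup>H ** (H ** A) + (H ** A)\<^sup>H ** (\<Phi> ** A) - 0)) (at \<Phi>)"
    by (intro has_derivative_diff has_derivative_const has_derivative_matrix_mult
      has_derivative_hermitian_transpose)
  ultimately show ?thesis
    by (simp add: hermitian_transpose_mult matrix_mul_assoc)
qed

theorem lemma1:
  fixes a :: "real \<times> real \<Rightarrow> complex^'n"
    and \<Theta> :: "(real \<times> real)^'l"
    and A :: "complex^'l^'n"
    and \<Phi> :: "complex^'n^'m"
  assumes "CARD('m) < CARD('n)"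
    and "\<And>l. \<Theta> $ l \<in> {0..<2 * pi} \<times> {0<..<pi}"
    and "A = manifold_matrix a \<Theta>"
  shows "GDERIV (\<lambda>\<Psi> :: complex^'n^'m. (norm (gram_error A \<Psi>))\<^sup>2) \<Phi> :>
    4 *\<^sub>R (\<Phi> ** A ** A\<^sup>H ** gram \<Phi> ** A ** A\<^sup>H) - 4 *\<^sub>R (\<Phi> ** A ** A\<^sup>H ** A ** A\<^sup>H)"
proof -
  define E where "E = gram_error A \<Phi>"
  define D where "D H = A\<^sup>H ** \<Phi>\<^sup>H ** H ** A" for H
  let ?G = "4 *\<^sub>R (\<Phi> ** A ** A\<^sup>H ** gram \<Phi> ** A ** A\<^sup>H) - 4 *\<^sub>R (\<Phi> ** A ** A\<^sup>H ** A ** A\<^sup>H)"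
  \<comment> \<open>The two terms of the claimed gradient combine into the single product that the
    adjoint rules produce.\<close>
  have G: "?G = 4 *\<^sub>R (\<Phi> ** A ** E ** A\<^sup>H)"
    by (simp add: E_def gram_error_def matrix_mul_assoc scaleR_diff_right
      bounded_bilinear.diff_left[OF bounded_bilinear_matrix_mult]
      bounded_bilinear.diff_right[OF bounded_bilinear_matrix_mult])
  have "((\<lambda>\<Psi>. gram_error A \<Psi> \<bullet> gram_error A \<Psi>) has_derivative
      (\<lambda>H. E \<bullet> (D H + (D H)\<^sup>H) + (D H + (D H)\<^sup>H) \<bullet> E)) (at \<Phi>)"
    unfolding E_def D_def by (intro has_derivative_inner has_derivative_gram_error)
  moreover have "E \<bullet> (D H + (D H)\<^sup>H) + (D H + (D H)\<^sup>H) \<bullet> E = H \<bullet> ?G" for H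
  proof -
    have "E \<bullet> (D H)\<^sup>H = E \<bullet> D H"
      using inner_hermitian_transpose[of E "D H"] by (simp add: E_def)
    \<comment> \<open>The right factor \<open>A\<close> moves across as \<open>A\<^sup>H\<close>,
      and the left factor \<open>A\<^sup>H ** \<Phi>\<^sup>H\<close> as
      \<open>\<Phi> ** A\<close>.\<close>
    moreover have "E \<bullet> D H = (\<Phi> ** A ** E ** A\<^sup>H) \<bullet> H"
      by (simp add: D_def inner_matrix_mult_right[of E _ A]
        inner_matrix_mult_left[of _ "A\<^sup>H ** \<Phi>\<^sup>H"] hermitian_transpose_mult matrix_mul_assoc)
    \<comment> \<open>The factor 4 counts four equal terms: two from differentiating the square,
      each split in two by \<open>D H\<close> and its conjugate transpose.\<close>
    ultimately show ?thesis
      unfolding G by (simp add: inner_commute inner_add_right)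
  qed
  ultimately show ?thesis
    by (simp only: gderiv_def power2_norm_eq_inner)
qed

end
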